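(* Let $d \geq 1$ and $n \geq d$ be integers, and let $\mathbf{x}_1, \dots, \mathbf{x}_n$ be points in $[0,1]^d$. Assume that there is no box $A \in \mathcal{A}^*$ such that the right upper boundary of $A$ contains at least $d/4$ of the points $\mathbf{x}_1, \dots, \mathbf{x}_n$. Then $$ D_n^*(\mathbf{x}_1, \dots, \mathbf{x}_n) \geq \frac{d^{3/4}}{372\, n^{3/4}}. $$
   Context: Let $\mathcal{A}^*$ denote the class of all closed axis-parallel boxes in $[0,1]^d$ which have one vertex at the origin, i.e. the boxes $[\mathbf{0},\mathbf{a}] = [0,a_1]\times\dots\times[0,a_d]$ with $\mathbf{a}=(a_1,\dots,a_d) \in [0,1]^d$. The right upper boundary of a box $A=[\mathbf{0},\mathbf{a}] \in \mathcal{A}^*$ is the union of all those $(d-1)$-dimensional faces of $A$ which are adjacent to the vertex $\mathbf{a}$, i.e. the set of all $\mathbf{y} \in A$ with $y_j = a_j$ for at least one $j \in \{1,\dots,d\}$. The star-discrepancy of points $\mathbf{x}_1, \dots, \mathbf{x}_n \in [0,1]^d$ is $$ D_n^*(\mathbf{x}_1, \dots, \mathbf{x}_n) = \sup_{A \in \mathcal{A}^*} \left| \frac{1}{n} \sum_{k=1}^n \mathbf{1}_A(\mathbf{x}_k) - \mathrm{vol}(A) \right|, $$ where $\mathbf{1}_A$ is the indicator function of $A$ and $\mathrm{vol}$ is $d$-dimensional Lebesgue measure. The points $\mathbf{x}_1,\dots,\mathbf{x}_n$ are not required to be distinct (they form a multiset, and points are counted with multiplicity). *)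

theory Defs
  imports "HOL-Analysis.Analysis"
begin

definition unit_cube :: "(real ^ 'd) set" where
  "unit_cube = {x. \<forall>i. 0 \<le> x $ i \<and> x $ i \<le> 1}"

text \<open>The closed box with opposite vertices \<open>0\<close> and \<open>a\<close> is \<open>cbox 0 a\<close>. Degenerate boxes
  (some coordinate of \<open>a\<close> is zero) are included.\<close>

definition anchored_boxes :: "(real ^ 'd) set set" where
  "anchored_boxes = {cbox 0 a |a. a \<in> unit_cube}"

text \<open>The right upper boundary of \<open>cbox 0 a\<close>, as a function of the vertex \<open>a\<close>. For \<open>a\<close> in the
  unit cube the box determines \<open>a\<close>, so this depends only on the box.\<close>

definition right_upper_boundary :: "real ^ 'd \<Rightarrow> (real ^ 'd) set" where
  "right_upper_boundary a = {y \<in> cbox 0 a. \<exists>j. y $ j = a $ j}"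

text \<open>The points are \<open>x 1, \<dots>, x n\<close>, counted with multiplicity; values of \<open>x\<close> at other indices
  are irrelevant.\<close>

definition star_discrepancy :: "nat \<Rightarrow> (nat \<Rightarrow> real ^ 'd) \<Rightarrow> real" where
  "star_discrepancy n x =
    (SUP A\<in>anchored_boxes. \<bar>(1 / real n) * (\<Sum>k=1..n. indicator A (x k)) - measure lebesgue A\<bar>)"

text \<open>The supremum above is over a nonempty set that is bounded above, so it is a genuine
  supremum in the reals.\<close>

lemma anchored_boxes_nonempty: "(anchored_boxes :: (real ^ 'd) set set) \<noteq> {}"
proof -
  have "(0 :: real ^ 'd) \<in> unit_cube"
    by (simp add: unit_cube_def)
  then show ?thesis
    unfolding anchored_boxes_def by blast
qed

lemma bdd_above_local_discrepancy:
  fixes x :: "nat \<Rightarrow> real ^ 'd"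
  shows "bdd_above ((\<lambda>A. \<bar>(1 / real n) * (\<Sum>k=1..n. indicator A (x k)) - measure lebesgue A\<bar>)
    ` anchored_boxes)"
proof (rule bdd_aboveI2)
  fix A :: "(real ^ 'd) set"
  assume "A \<in> anchored_boxes"
  then obtain a where a: "a \<in> unit_cube" and A: "A = cbox 0 a"
    by (auto simp: anchored_boxes_def)
  have "cbox 0 a \<subseteq> cbox 0 (\<chi> i. 1)"
    using a unfolding subset_iff mem_box_cart unit_cube_def
    by (simp, meson order_trans)
  then have "measure lebesgue A \<le> measure lebesgue (cbox 0 (\<chi> i. 1) :: (real ^ 'd) set)"
    unfolding A by (intro measure_mono_fmeasurable) auto
  moreover have "(1 / real n) * (\<Sum>k=1..n. indicator A (x k)) \<le> (1 / real n) * (\<Sum>k=1..n. 1)"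
    by (intro mult_left_mono sum_mono) (auto simp: indicator_def)
  moreover have "(0 :: real) \<le> (1 / real n) * (\<Sum>k=1..n. indicator A (x k))"
    by (intro mult_nonneg_nonneg sum_nonneg) auto
  ultimately show "\<bar>(1 / real n) * (\<Sum>k=1..n. indicator A (x k)) - measure lebesgue A\<bar>
      \<le> (1 / real n) * (\<Sum>k=1..n. 1)
        + measure lebesgue (cbox 0 (\<chi> i. 1) :: (real ^ 'd) set)"
    using measure_nonneg[of lebesgue A] by linarith
qed

end

theory Submission
  imports Defs
begin

text \<open>
  The points lying in a box \<open>[0, a]\<close> are determined by the set \<open>E\<close> of those among them that are
  chosen to attain a coordinatewise maximum. All of \<open>E\<close> lies on the right upper boundary of one
  box, so it has fewer than \<open>d / 4\<close> elements, and boxes cut out at most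
  \<open>(n / d) powr (d / 4) * exp d\<close> different subsets of the point set. Among the \<open>q ^ d\<close> boxes with
  vertices \<open>exp (- u\<^sub>j / (q d))\<close>, where \<open>u\<^sub>j < q\<close> and \<open>q\<close> is about \<open>14 (n / d) powr (1 / 4)\<close>, more
  than \<open>4 ^ d\<close> therefore contain the same points. Their intersection also contains the same points,
  yet by counting one of them exceeds it in volume by at least a constant times \<open>1 / q\<close>.
\<close>

section \<open>Counting by exponential weights\<close>

text \<open>Give \<open>E\<close> the weight \<open>(1 / t) ^ card E\<close>. Each set that is
  counted has weight at least \<open>t powr (- s)\<close>, while the weights of all subsets add up
  to \<open>(1 + 1 / t) ^ card A\<close>, which is at most \<open>exp (card A / t)\<close>.\<close>

lemma card_small_subsets_le:
  fixes t s :: real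
  assumes "finite A" "1 \<le> t"
  shows "real (card {E \<in> Pow A. real (card E) \<le> s}) \<le> t powr s * exp (real (card A) / t)"
proof -
  have t: "0 < t"
    using assms by simp
  have "real (card {E \<in> Pow A. real (card E) \<le> s}) * t powr (- s)
      = (\<Sum>E | E \<in> Pow A \<and> real (card E) \<le> s. t powr (- s))"
    by simp
  also have "\<dots> \<le> (\<Sum>E | E \<in> Pow A \<and> real (card E) \<le> s. (1 / t) ^ card E)"
  proof (rule sum_mono)
    fix E assume "E \<in> {E. E \<in> Pow A \<and> real (card E) \<le> s}"
    then have "t powr (- s) \<le> t powr (- real (card E))"
      using assms by (intro powr_mono) auto
    also have "\<dots> = (1 / t) ^ card E"
      using t by (simp add: powr_minus powr_realpow power_one_over divide_inverse power_inverse)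
    finally show "t powr (- s) \<le> (1 / t) ^ card E" .
  qed
  also have "\<dots> \<le> (\<Sum>E\<in>Pow A. (1 / t) ^ card E)"
    using assms t by (intro sum_mono2) auto
  also have "\<dots> = (\<Prod>x\<in>A. 1 / t + 1)"
    using assms by (subst prod_add) auto
  also have "\<dots> \<le> exp (1 / t) ^ card A"
    using t exp_ge_add_one_self[of "1 / t"] by (simp add: power_mono add.commute)
  also have "\<dots> = exp (real (card A) / t)"
    by (simp add: exp_of_nat_mult[symmetric])
  finally show ?thesis
    using t by (simp add: powr_minus field_simps)
qed

text \<open>Give \<open>v\<close> the weight \<open>1 / 2\<close> to the power of its sum. Each
  function that is counted has weight at least \<open>(1 / 2) ^ r\<close>, and the total weight
  factors into one geometric sum per index, each at most 2. The bound does not depend on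
  \<open>q\<close>.\<close>

lemma card_bounded_sum_functions_le:
  fixes I :: "'i set"
  assumes "finite I"
  shows "card {v \<in> PiE I (\<lambda>_. {..<q}). (\<Sum>j\<in>I. v j) \<le> r} \<le> 2 ^ r * 2 ^ card I"
proof -
  let ?V = "PiE I (\<lambda>_. {..<q :: nat})"
  let ?W = "{v \<in> ?V. (\<Sum>j\<in>I. v j) \<le> r}"
  have fin: "finite ?V"
    using assms by (intro finite_PiE) auto
  have "real (card ?W) * (1 / 2) ^ r = (\<Sum>v\<in>?W. (1 / 2) ^ r)"
    by simp
  also have "\<dots> \<le> (\<Sum>v\<in>?W. (1 / 2) ^ (\<Sum>j\<in>I. v j))"
    by (intro sum_mono power_decreasing) auto
  also have "\<dots> \<le> (\<Sum>v\<in>?V. (1 / 2) ^ (\<Sum>j\<in>I. v j))"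
    using fin by (intro sum_mono2) auto
  also have "\<dots> = (\<Prod>j\<in>I. \<Sum>m<q. (1 / 2) ^ m)"
    using assms by (subst prod_sum_PiE) (auto simp: power_sum)
  also have "\<dots> \<le> (\<Prod>j\<in>I. 2 :: real)"
    by (intro prod_mono) (auto simp: sum_gp_strict power_le_one intro!: sum_nonneg)
  finally have "real (card ?W) \<le> real (2 ^ r * 2 ^ card I)"
    by (simp add: field_simps)
  then show ?thesis
    by (simp only: of_nat_le_iff)
qed

lemma card_le_mult_of_fibers:
  assumes "finite T" "f ` U \<subseteq> T" "\<And>y. y \<in> T \<Longrightarrow> card {u \<in> U. f u = y} \<le> m"
  shows "card U \<le> card T * m"
proof -
  have "U = (\<Union>y\<in>T. {u \<in> U. f u = y})"
    using assms(2) by auto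
  then have "card U \<le> (\<Sum>y\<in>T. card {u \<in> U. f u = y})"
    using card_UN_le[OF assms(1), of "\<lambda>y. {u \<in> U. f u = y}"] by simp
  also have "\<dots> \<le> card T * m"
    using sum_bounded_above[of T "\<lambda>y. card {u \<in> U. f u = y}" m] assms(3) by simp
  finally show ?thesis .
qed

section \<open>Coding the points in a box by few of them\<close>

text \<open>Indices are collected instead of points, so that the cardinality counts
  multiplicity.\<close>

definition trace_of :: "nat \<Rightarrow> (nat \<Rightarrow> real ^ 'd) \<Rightarrow> real ^ 'd \<Rightarrow> nat set" where
  "trace_of n x a = {k \<in> {1..n}. x k \<in> cbox 0 a}"

text \<open>For each coordinate pick an index of the trace that is maximal there. The picked points
  lie on the right upper boundary of the box whose vertex consists of these maxima, so
  \<open>few\<close> bounds their number. The description by \<open>E\<close> does not mention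
  \<open>a\<close>, hence there are at most as many traces as sets \<open>E\<close>.\<close>

lemma trace_of_eq_dominated:
  fixes x :: "nat \<Rightarrow> real ^ 'd"
  assumes x: "\<And>k. k \<in> {1..n} \<Longrightarrow> x k \<in> unit_cube"
    and few: "\<And>a. a \<in> unit_cube \<Longrightarrow>
      real (card {k \<in> {1..n}. x k \<in> right_upper_boundary a}) \<le> s"
  obtains E where "E \<subseteq> {1..n}" "real (card E) \<le> s"
    "trace_of n x a = {k \<in> {1..n}. \<forall>j. \<exists>e\<in>E. x k $ j \<le> x e $ j}"
proof (cases "trace_of n x a = {}")
  case True
  have "(0 :: real ^ 'd) \<in> unit_cube"
    by (simp add: unit_cube_def)
  from few[OF this] have "0 \<le> s"
    using of_nat_0_le_iff order_trans by blast
  \<comment> \<open>There is at least one coordinate, so the empty \<open>E\<close> dominates no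
    point.\<close>
  then show ?thesis
    using that[of "{}"] True by auto
next
  case False
  let ?I = "trace_of n x a"
  have fin: "finite ?I"
    by (simp add: trace_of_def)
  have "\<exists>e\<in>?I. \<forall>k\<in>?I. x k $ j \<le> x e $ j" for j
  proof -
    have "Max ((\<lambda>k. x k $ j) ` ?I) \<in> (\<lambda>k. x k $ j) ` ?I"
      using fin False by (intro Max_in) auto
    then obtain e where "e \<in> ?I" "Max ((\<lambda>k. x k $ j) ` ?I) = x e $ j"
      by auto
    then show ?thesis
      using fin by (metis Max_ge finite_imageI imageI)
  qed
  then obtain e where e: "\<And>j. e j \<in> ?I" and max: "\<And>j k. k \<in> ?I \<Longrightarrow> x k $ j \<le> x (e j) $ j"
    by metis
  define b where "b = (\<chi> j. x (e j) $ j)"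
  have sub: "range e \<subseteq> {1..n}"
    using e by (auto simp: trace_of_def)
  have "b \<in> unit_cube"
    using x[of "e _"] sub by (simp add: b_def unit_cube_def image_subset_iff)
  moreover have "range e \<subseteq> {k \<in> {1..n}. x k \<in> right_upper_boundary b}"
    using e max by (auto simp: right_upper_boundary_def b_def mem_box_cart trace_of_def)
  ultimately have "real (card (range e)) \<le> s"
    using few[of b] card_mono[of "{k \<in> {1..n}. x k \<in> right_upper_boundary b}" "range e"]
    by simp
  moreover have "?I = {k \<in> {1..n}. \<forall>j. \<exists>i\<in>range e. x k $ j \<le> x i $ j}"
  proof (intro equalityI subsetI)
    fix k assume "k \<in> ?I"
    then show "k \<in> {k \<in> {1..n}. \<forall>j. \<exists>i\<in>range e. x k $ j \<le> x i $ j}"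
      using max by (auto simp: trace_of_def)
  next
    fix k assume k: "k \<in> {k \<in> {1..n}. \<forall>j. \<exists>i\<in>range e. x k $ j \<le> x i $ j}"
    have "x k $ j \<le> a $ j" for j
    proof -
      obtain i where "x k $ j \<le> x (e i) $ j"
        using k by auto
      also have "\<dots> \<le> a $ j"
        using e[of i] by (auto simp: trace_of_def mem_box_cart)
      finally show ?thesis .
    qed
    then show "k \<in> ?I"
      using k x[of k] by (auto simp: trace_of_def mem_box_cart unit_cube_def)
  qed
  ultimately show ?thesis
    using that sub by blast
qed

section \<open>Boxes of an exponential grid with a common trace\<close>

lemma local_discrepancy_le:
  fixes x :: "nat \<Rightarrow> real ^ 'd"
  assumes "a \<in> unit_cube"
  shows "\<bar>real (card (trace_of n x a)) / real n - (\<Prod>j\<in>UNIV. a $ j)\<bar> \<le> star_discrepancy n x"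
proof -
  have "cbox 0 a \<in> anchored_boxes"
    using assms by (auto simp: anchored_boxes_def)
  then have "\<bar>(1 / real n) * (\<Sum>k=1..n. indicator (cbox 0 a) (x k)) - measure lebesgue (cbox 0 a)\<bar>
      \<le> star_discrepancy n x"
    unfolding star_discrepancy_def by (rule cSUP_upper[OF _ bdd_above_local_discrepancy])
  moreover have "(\<Sum>k=1..n. indicator (cbox 0 a) (x k)) = real (card (trace_of n x a))"
    by (simp add: trace_of_def indicator_def sum.If_cases Int_def)
  moreover have ne: "cbox 0 a \<noteq> {}"
    using assms by (simp add: interval_ne_empty_cart unit_cube_def)
  have "measure lebesgue (cbox 0 a) = (\<Prod>j\<in>UNIV. a $ j)"
    by (subst measure_completion) (auto simp: content_cbox_cart ne)
  ultimately show ?thesis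
    by simp
qed

text \<open>With coordinates on a geometric scale, the volume of the box depends only on the sum of
  the \<open>u j\<close>.\<close>

definition exp_vertex :: "real \<Rightarrow> ('d \<Rightarrow> nat) \<Rightarrow> real ^ 'd" where
  "exp_vertex h u = (\<chi> j. exp (- h * real (u j)))"

lemma exp_vertex_in_unit_cube: "0 \<le> h \<Longrightarrow> exp_vertex h u \<in> unit_cube"
  by (simp add: exp_vertex_def unit_cube_def)

lemma prod_exp_vertex:
  "(\<Prod>j\<in>UNIV. exp_vertex h u $ j) = exp (- h * real (\<Sum>j\<in>UNIV. u j))"
  by (simp add: exp_vertex_def exp_sum[symmetric] sum_distrib_left sum_negf)

text \<open>Boxes with a common trace differ little in volume from their intersection, which is
  again a grid box. The exponents of each are therefore close to those of the intersection in total,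
  and few exponent vectors are that close.\<close>

lemma card_same_trace_le:
  fixes x :: "nat \<Rightarrow> real ^ 'd" and C :: "('d \<Rightarrow> nat) set"
  assumes "0 < q" and C: "C \<subseteq> PiE UNIV (\<lambda>_. {..<q})"
    and h: "h = 1 / (real q * real CARD('d))"
    and same: "\<And>u. u \<in> C \<Longrightarrow> trace_of n x (exp_vertex h u) = I"
    and small: "2 * star_discrepancy n x < exp (- 1) * (1 - exp (- 1 / real q))"
  shows "card C \<le> 4 ^ CARD('d)"
proof (cases "C = {}")
  case False
  have finC: "finite C"
    using C by (rule finite_subset) (auto intro!: finite_PiE)
  have h0: "0 < h"
    using assms(1) by (simp add: h)
  \<comment> \<open>Larger exponents give smaller coordinates, so \<open>w\<close> belongs to the
    intersection of the boxes given by \<open>C\<close>.\<close>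
  define w where "w j = Max ((\<lambda>u. u j) ` C)" for j
  have w_ge: "u j \<le> w j" if "u \<in> C" for u j
    unfolding w_def using that finC by (intro Max_ge) auto
  have w_attained: "\<exists>u\<in>C. w j = u j" for j
  proof -
    have "w j \<in> (\<lambda>u. u j) ` C"
      unfolding w_def using finC False by (intro Max_in) auto
    then show ?thesis by auto
  qed
  have w_less: "w j < q" for j
    using w_attained[of j] C by (auto simp: PiE_def Pi_def)
  have trace_w: "trace_of n x (exp_vertex h w) = I"
  proof (intro equalityI subsetI)
    obtain u where u: "u \<in> C"
      using False by auto
    fix k assume k: "k \<in> trace_of n x (exp_vertex h w)"
    have "exp_vertex h w $ j \<le> exp_vertex h u $ j" for j
      using w_ge[OF u] h0 by (simp add: exp_vertex_def)
    then have "k \<in> trace_of n x (exp_vertex h u)"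
      using k unfolding trace_of_def by (auto simp: mem_box_cart intro: order_trans)
    then show "k \<in> I"
      using same[OF u] by simp
  next
    fix k assume k: "k \<in> I"
    have "k \<in> {1..n} \<and> 0 \<le> x k $ j \<and> x k $ j \<le> exp_vertex h w $ j" for j
    proof -
      obtain u where "u \<in> C" "w j = u j"
        using w_attained by blast
      then show ?thesis
        using k same[of u] by (auto simp: trace_of_def mem_box_cart exp_vertex_def)
    qed
    then show "k \<in> trace_of n x (exp_vertex h w)"
      by (simp add: trace_of_def mem_box_cart)
  qed
  \<comment> \<open>Otherwise passing from \<open>u\<close> to \<open>w\<close> shrinks the volume
    by a factor of at most \<open>exp (- h * d) = exp (- 1 / q)\<close>, where \<open>d\<close> is
    the dimension.\<close>
  have gap: "(\<Sum>j\<in>UNIV. w j - u j) \<le> CARD('d)" if u: "u \<in> C" for u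
  proof (rule ccontr)
    assume neg: "\<not> ?thesis"
    let ?su = "\<Sum>j\<in>UNIV. u j" and ?sw = "\<Sum>j\<in>UNIV. w j"
    have "(\<Sum>j\<in>UNIV. w j - u j) = ?sw - ?su"
      using w_ge[OF u] by (intro sum_subtractf_nat) auto
    then have "real ?su + real CARD('d) \<le> real ?sw"
      using neg by linarith
    then have "h * real CARD('d) + h * real ?su \<le> h * real ?sw"
      using h0 by (simp add: distrib_left[symmetric] add.commute)
    moreover have hd: "h * real CARD('d) = 1 / real q"
      by (simp add: h)
    ultimately have "- h * real ?sw \<le> - h * real ?su + - 1 / real q"
      by simp
    then have "exp (- h * real ?sw) \<le> exp (- h * real ?su + - 1 / real q)"
      by simp
    also have "\<dots> = exp (- h * real ?su) * exp (- 1 / real q)"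
      by (rule exp_add)
    finally have "exp (- h * real ?su) * (1 - exp (- 1 / real q))
        \<le> exp (- h * real ?su) - exp (- h * real ?sw)"
      by (simp add: right_diff_distrib)
    \<comment> \<open>Since \<open>h * d * q = 1\<close>, the box of \<open>u\<close> has volume at
      least \<open>exp (- 1)\<close>.\<close>
    moreover have "?su \<le> CARD('d) * q"
      using sum_bounded_above[of UNIV u q] C u by (force simp: PiE_def Pi_def intro: less_imp_le)
    then have "h * real ?su \<le> h * real (CARD('d) * q)"
      using h0 by (intro mult_left_mono of_nat_mono) auto
    then have "- 1 \<le> - h * real ?su"
      using assms(1) by (simp add: h)
    then have "exp (- 1) * (1 - exp (- 1 / real q))
        \<le> exp (- h * real ?su) * (1 - exp (- 1 / real q))"
      by (intro mult_right_mono) auto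
    \<comment> \<open>Both volumes are compared with the same proportion \<open>card I / n\<close>
      of points, whence the factor 2.\<close>
    moreover have "exp (- h * real ?su) - exp (- h * real ?sw) \<le> 2 * star_discrepancy n x"
      using local_discrepancy_le[OF exp_vertex_in_unit_cube, of h n x u]
        local_discrepancy_le[OF exp_vertex_in_unit_cube, of h n x w] h0
      unfolding trace_w same[OF u] prod_exp_vertex by linarith
    ultimately show False
      using small by linarith
  qed
  let ?g = "\<lambda>(u :: 'd \<Rightarrow> nat) j. w j - u j"
  have "inj_on ?g C"
  proof (rule inj_onI, rule ext)
    fix u v j assume "u \<in> C" "v \<in> C" "?g u = ?g v"
    then show "u j = v j"
      using w_ge[of u j] w_ge[of v j] by (metis diff_diff_cancel)
  qed
  moreover have "?g ` C \<subseteq> {v \<in> PiE UNIV (\<lambda>_. {..<q}). (\<Sum>j\<in>UNIV. v j) \<le> CARD('d)}"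
    using gap w_less by (auto intro: le_less_trans[OF diff_le_self])
  moreover have "finite {v \<in> PiE (UNIV :: 'd set) (\<lambda>_. {..<q}). (\<Sum>j\<in>UNIV. v j) \<le> CARD('d)}"
    by (intro finite_subset[OF _ finite_PiE[of UNIV "\<lambda>_. {..<q}"]]) auto
  ultimately have "card C \<le> 2 ^ CARD('d) * 2 ^ CARD('d)"
    using card_inj_on_le card_bounded_sum_functions_le[of "UNIV :: 'd set" q "CARD('d)"]
    by (meson finite_class.finite_UNIV order_trans)
  then show ?thesis
    by (simp flip: power_mult_distrib)
qed simp

section \<open>Choice of the grid and comparison of the counts\<close>

theorem theorem2:
  fixes n :: nat and x :: "nat \<Rightarrow> real ^ 'd"
  assumes "n \<ge> CARD('d)"
    and "\<And>k. k \<in> {1..n} \<Longrightarrow> x k \<in> unit_cube"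
    and "\<not> (\<exists>a\<in>unit_cube.
           real (card {k \<in> {1..n}. x k \<in> right_upper_boundary a}) \<ge> real CARD('d) / 4)"
  shows "star_discrepancy n x
           \<ge> real CARD('d) powr (3 / 4) / (372 * real n powr (3 / 4))"
proof (rule ccontr)
  assume neg: "\<not> ?thesis"
  let ?d = "CARD('d)"
  define t where "t = real n / real ?d"
  define b where "b = t powr (1 / 4)"
  \<comment> \<open>The count of traces is contradicted once \<open>q\<close> exceeds
    \<open>4 * exp 1 * b\<close>, which is at most \<open>12 * b\<close>. The factor 14 leaves room
    for rounding down, as \<open>b\<close> is at least 1, and keeps \<open>1 / q\<close> of order
    \<open>1 / b\<close>.\<close>
  define q where "q = nat \<lfloor>14 * b\<rfloor>"
  define h where "h = 1 / (real q * real ?d)"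
  have d0: "0 < real ?d"
    by simp
  have t1: "1 \<le> t"
    using assms(1) by (simp add: t_def)
  have b1: "1 \<le> b"
    using t1 by (simp add: b_def ge_one_powr_ge_zero)
  have q_gt: "12 * b < real q" and q_le: "real q \<le> 14 * b"
    using b1 unfolding q_def by linarith+
  have q0: "0 < q"
    using q_gt b1 by (cases q) auto
  have small: "2 * star_discrepancy n x < exp (- 1) * (1 - exp (- 1 / real q))"
  proof -
    have "real ?d powr (3 / 4) / (372 * real n powr (3 / 4)) = 1 / (372 * b ^ 3)"
    proof -
      have "b ^ 3 = t powr (3 / 4)"
        using t1 by (simp add: b_def powr_powr powr_realpow[symmetric])
      then show ?thesis
        using d0 by (simp add: t_def powr_divide)
    qed
    \<comment> \<open>The volume gap is of order \<open>1 / q\<close>, hence of order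
      \<open>1 / b\<close>, so this weaker bound suffices.\<close>
    also have "\<dots> \<le> 1 / (372 * b)"
      using b1 by (intro divide_left_mono) (auto simp: self_le_power)
    finally have "2 * star_discrepancy n x < 2 / (372 * b)"
      using neg by simp
    \<comment> \<open>Here \<open>3 * (1 + 14 * b)\<close> is at most \<open>45 * b\<close>, well
      below \<open>186 * b\<close>.\<close>
    also have "\<dots> \<le> 1 / 3 * (1 / (1 + 14 * b))"
      using b1 by (simp add: field_simps)
    also have "\<dots> \<le> 1 / 3 * (1 / (1 + real q))"
      using b1 q_le by (intro mult_left_mono divide_left_mono) auto
    also have "\<dots> \<le> exp (- 1) * (1 - exp (- 1 / real q))"
    proof (intro mult_mono)
      show "1 / 3 \<le> exp (- 1 :: real)"
        using exp_le by (simp add: exp_minus field_simps)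
      have "1 + 1 / real q \<le> exp (1 / real q)"
        by (rule exp_ge_add_one_self)
      then have "exp (- 1 / real q) \<le> 1 / (1 + 1 / real q)"
        using q0 by (simp add: exp_minus field_simps add_pos_pos)
      also have "\<dots> = 1 - 1 / (1 + real q)"
        using q0 by (simp add: field_simps)
      finally show "1 / (1 + real q) \<le> 1 - exp (- 1 / real q)"
        by simp
    qed auto
    finally show ?thesis .
  qed
  define T where "T = {E \<in> Pow {1..n}. real (card E) \<le> real ?d / 4}"
  let ?U = "PiE (UNIV :: 'd set) (\<lambda>_. {..<q})"
  have "\<exists>E. E \<in> T \<and> trace_of n x a = {k \<in> {1..n}. \<forall>j. \<exists>e\<in>E. x k $ j \<le> x e $ j}" for a
  proof -
    obtain E where "E \<subseteq> {1..n}" "real (card E) \<le> real ?d / 4"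
      "trace_of n x a = {k \<in> {1..n}. \<forall>j. \<exists>e\<in>E. x k $ j \<le> x e $ j}"
      using assms(2,3) by (elim trace_of_eq_dominated[where s = "real ?d / 4" and a = a]) force+
    then show ?thesis
      by (auto simp: T_def)
  qed
  \<comment> \<open>The code \<open>f a\<close> determines the trace, so boxes with equal codes
    contain the same points.\<close>
  then have "\<exists>f. \<forall>a. f a \<in> T \<and>
      trace_of n x a = {k \<in> {1..n}. \<forall>j. \<exists>e\<in>f a. x k $ j \<le> x e $ j}"
    by (intro choice allI)
  then obtain f where f: "\<And>a. f a \<in> T"
    "\<And>a. trace_of n x a = {k \<in> {1..n}. \<forall>j. \<exists>e\<in>f a. x k $ j \<le> x e $ j}"
    by blast
  have "card ?U \<le> card T * 4 ^ ?d"
  proof (rule card_le_mult_of_fibers[where f = "\<lambda>u. f (exp_vertex h u)"])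
    show "finite T"
      by (simp add: T_def)
    show "(\<lambda>u. f (exp_vertex h u)) ` ?U \<subseteq> T"
      using f(1) by auto
    show "card {u \<in> ?U. f (exp_vertex h u) = E} \<le> 4 ^ ?d" for E
      by (rule card_same_trace_le[OF q0 _ h_def _ small,
            where I = "{k \<in> {1..n}. \<forall>j. \<exists>e\<in>E. x k $ j \<le> x e $ j}"]) (auto simp: f(2))
  qed
  then have "real q ^ ?d \<le> real (card T) * 4 ^ ?d"
    by (simp add: card_PiE flip: of_nat_le_iff[where 'a = real])
  also have "real (card T) \<le> t powr (real ?d / 4) * exp (real (card {1..n}) / t)"
    unfolding T_def by (rule card_small_subsets_le[OF _ t1]) simp
  \<comment> \<open>The choice \<open>t = n / d\<close> makes the exponential factor a
    \<open>d\<close>-th power, like all the others, so that \<open>d\<close>-th roots can be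
    taken.\<close>
  also have "real (card {1..n}) / t = real ?d"
    using t1 d0 by (cases "n = 0") (simp_all add: t_def)
  also have "t powr (real ?d / 4) = b ^ ?d"
    using t1 by (simp add: b_def powr_powr powr_realpow[symmetric])
  also have "exp (real ?d) = exp 1 ^ ?d"
    by (simp flip: exp_of_nat_mult)
  finally have "real q ^ ?d \<le> (b * exp 1 * 4) ^ ?d"
    by (simp add: power_mult_distrib)
  then have "real q \<le> b * exp 1 * 4"
    using b1 by (subst (asm) power_mono_iff) auto
  also have "\<dots> \<le> b * 3 * 4"
    using b1 exp_le by (intro mult_mono) auto
  finally show False
    using q_gt by simp
qed

end
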